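(* Let $G$ be a connected block graph of order at least $2$. Then the following are equivalent: (a) $G$ is $\alpha$-excellent; (b) $G\in\mathcal{F}$; (c) $G$ has a perfect block-cover.
   Context: All graphs are finite and simple. A graph is $\alpha$-excellent if every vertex is contained in some maximum independent set. A block is a maximal connected subgraph without a cut-vertex of its own; a block graph is a graph each of whose blocks is complete. A perfect block-cover of a block graph $G$ is a family of pairwise vertex-disjoint blocks of $G$ such that every vertex of $G$ belongs to some block of the family. For a complete graph $K_n$ with vertices $v_1,\ldots,v_n$ ($n\ge1$) and complete graphs $H_1,\ldots,H_n$, the general corona $K_n\circ\{H_1,\ldots,H_n\}$ is the disjoint union of $K_n,H_1,\ldots,H_n$ with $v_i$ joined to every vertex of $H_i$ for each $i$; the complete subgraph on $v_1,\ldots,v_n$ is its body. The family $\mathcal{F}$ is the smallest family of graphs that contains every complete graph of order at least $2$ and is closed under the following operation: if $G'\in\mathcal{F}$, $v\in V(G')$, and $H$ is a general corona of a complete graph by a family of complete graphs, then the graph obtained from the disjoint union $G'\cup H$ by adding all edges joining $v$ to the vertices of the body of $H$ belongs to $\mathcal{F}$. *)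

theory Defs
  imports Main
begin

datatype 'a graph = Graph (verts: "'a set") (edges: "'a set set")

definition simple_graph :: "'a graph \<Rightarrow> bool" where
  "simple_graph G \<longleftrightarrow>
     finite (verts G) \<and> (\<forall>e \<in> edges G. e \<subseteq> verts G \<and> card e = 2)"

definition adj :: "'a graph \<Rightarrow> 'a \<Rightarrow> 'a \<Rightarrow> bool" where
  "adj G u v \<longleftrightarrow> {u, v} \<in> edges G"

(* As usual, a complete graph has at least one vertex. *)
definition complete_graph :: "'a graph \<Rightarrow> bool" where
  "complete_graph G \<longleftrightarrow> simple_graph G \<and> verts G \<noteq> {} \<and>
     (\<forall>u \<in> verts G. \<forall>v \<in> verts G. u \<noteq> v \<longrightarrow> adj G u v)"

definition subgraph :: "'a graph \<Rightarrow> 'a graph \<Rightarrow> bool" where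
  "subgraph H G \<longleftrightarrow> simple_graph H \<and> verts H \<subseteq> verts G \<and> edges H \<subseteq> edges G"

definition delete_vertex :: "'a graph \<Rightarrow> 'a \<Rightarrow> 'a graph" where
  "delete_vertex G v = Graph (verts G - {v}) {e \<in> edges G. v \<notin> e}"

definition connected_graph :: "'a graph \<Rightarrow> bool" where
  "connected_graph G \<longleftrightarrow> verts G \<noteq> {} \<and>
     (\<forall>u \<in> verts G. \<forall>v \<in> verts G. (adj G)\<^sup>*\<^sup>* u v)"

definition components :: "'a graph \<Rightarrow> 'a set set" where
  "components G = (\<lambda>u. {v \<in> verts G. (adj G)\<^sup>*\<^sup>* u v}) ` verts G"

(* Counting components means that the vertex of a one-vertex graph is no cut-vertex. *)
definition cut_vertex :: "'a graph \<Rightarrow> 'a \<Rightarrow> bool" where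
  "cut_vertex G v \<longleftrightarrow> v \<in> verts G \<and>
     card (components G) < card (components (delete_vertex G v))"

definition block :: "'a graph \<Rightarrow> 'a graph \<Rightarrow> bool" where
  "block G B \<longleftrightarrow>
     subgraph B G \<and> connected_graph B \<and> (\<nexists>v. cut_vertex B v) \<and>
     (\<forall>B'. subgraph B' G \<and> connected_graph B' \<and> (\<nexists>v. cut_vertex B' v) \<and> subgraph B B'
        \<longrightarrow> B' = B)"

definition block_graph :: "'a graph \<Rightarrow> bool" where
  "block_graph G \<longleftrightarrow> simple_graph G \<and> (\<forall>B. block G B \<longrightarrow> complete_graph B)"

definition perfect_block_cover :: "'a graph \<Rightarrow> 'a graph set \<Rightarrow> bool" where
  "perfect_block_cover G \<P> \<longleftrightarrow>
     (\<forall>B \<in> \<P>. block G B) \<and>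
     pairwise (\<lambda>B C. disjnt (verts B) (verts C)) \<P> \<and>
     (\<forall>v \<in> verts G. \<exists>B \<in> \<P>. v \<in> verts B)"

definition independent_set :: "'a graph \<Rightarrow> 'a set \<Rightarrow> bool" where
  "independent_set G S \<longleftrightarrow> S \<subseteq> verts G \<and> (\<forall>u \<in> S. \<forall>v \<in> S. \<not> adj G u v)"

definition maximum_independent_set :: "'a graph \<Rightarrow> 'a set \<Rightarrow> bool" where
  "maximum_independent_set G S \<longleftrightarrow> independent_set G S \<and>
     (\<forall>T. independent_set G T \<longrightarrow> card T \<le> card S)"

definition alpha_excellent :: "'a graph \<Rightarrow> bool" where
  "alpha_excellent G \<longleftrightarrow> (\<forall>v \<in> verts G. \<exists>S. maximum_independent_set G S \<and> v \<in> S)"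

(* Instead of numbering the vertices v_1, ..., v_n of the body K, the family is indexed
   by the vertices themselves: H x is the complete graph attached to the vertex x.
   Disjoint unions are unions of graphs with disjoint vertex sets; corona_family
   collects the requirements under which general_corona K H is the general corona. *)
definition corona_family :: "'a graph \<Rightarrow> ('a \<Rightarrow> 'a graph) \<Rightarrow> bool" where
  "corona_family K H \<longleftrightarrow>
     complete_graph K \<and> (\<forall>x \<in> verts K. complete_graph (H x)) \<and>
     (\<forall>x \<in> verts K. disjnt (verts K) (verts (H x))) \<and>
     (\<forall>x \<in> verts K. \<forall>y \<in> verts K. x \<noteq> y \<longrightarrow> disjnt (verts (H x)) (verts (H y)))"

definition general_corona :: "'a graph \<Rightarrow> ('a \<Rightarrow> 'a graph) \<Rightarrow> 'a graph" where
  "general_corona K H =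
     Graph (verts K \<union> (\<Union>x \<in> verts K. verts (H x)))
           (edges K \<union> (\<Union>x \<in> verts K. edges (H x))
             \<union> {{x, y} | x y. x \<in> verts K \<and> y \<in> verts (H x)})"

definition attach :: "'a graph \<Rightarrow> 'a \<Rightarrow> 'a graph \<Rightarrow> 'a set \<Rightarrow> 'a graph" where
  "attach G v H W =
     Graph (verts G \<union> verts H) (edges G \<union> edges H \<union> {{v, w} | w. w \<in> W})"

(* The graphs of the family with vertices in 'a. All graphs occurring in a construction
   of G are subgraphs of G, so no vertices outside 'a are needed, and as all choices of
   vertex names in 'a are allowed, the family is closed under isomorphism. *)
inductive_set family_F :: "'a graph set" where
  complete: "complete_graph G \<Longrightarrow> card (verts G) \<ge> 2 \<Longrightarrow> G \<in> family_F"
| attach_corona: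
    "G' \<in> family_F \<Longrightarrow> v \<in> verts G' \<Longrightarrow> corona_family K H \<Longrightarrow>
     disjnt (verts G') (verts (general_corona K H)) \<Longrightarrow>
     attach G' v (general_corona K H) (verts K) \<in> family_F"

end

theory Submission
  imports Defs
begin

text \<open>In a block graph two neighbours of \<open>u\<close> that are joined by a walk avoiding \<open>u\<close> are adjacent
  (\<open>clique_linked\<close>). Hence, with respect to the distance from a root, every other vertex has a
  unique parent, adjacent vertices of the same level have the same parent, and adjacency is
  transitive on siblings. In an \<open>\<alpha>\<close>-excellent graph, as in one partitioned into maximal cliques,
  no vertex \<open>x\<close> has two non-adjacent neighbours all of whose neighbours lie in \<open>N[x]\<close>
  (\<open>no_private_pair\<close>). Applied near the deepest level, this splits off a general corona unless the
  graph is complete. Independence numbers and partitions into maximal cliques pass through the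
  attachment of a corona in both directions, because every independent set contains at most one
  vertex of each clique formed by a body vertex and its leaves. The blocks of a block graph are its
  maximal cliques, so perfect block-covers are partitions into maximal cliques.\<close>

subsection \<open>Simple graphs and cliques\<close>

lemma adj_sym: "adj G u v \<longleftrightarrow> adj G v u"
  by (simp add: adj_def insert_commute)

lemma adjD:
  assumes "simple_graph G" "adj G u v"
  shows "u \<in> verts G" "v \<in> verts G" "u \<noteq> v"
proof -
  have "{u, v} \<subseteq> verts G" "card {u, v} = 2"
    using assms by (auto simp: simple_graph_def adj_def)
  then show "u \<in> verts G" "v \<in> verts G" "u \<noteq> v"
    by (auto simp: card_insert_if split: if_splits)
qed

lemma adj_rtranclp_sym: "(adj G)\<^sup>*\<^sup>* u v \<Longrightarrow> (adj G)\<^sup>*\<^sup>* v u"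
proof (induction rule: rtranclp_induct)
  case (step y z)
  then show ?case
    using adj_sym[of G y z] by (blast intro: converse_rtranclp_into_rtranclp)
qed simp

lemma adj_rtranclp_mono:
  assumes "\<And>x y. adj G x y \<Longrightarrow> adj H x y" "(adj G)\<^sup>*\<^sup>* u v"
  shows "(adj H)\<^sup>*\<^sup>* u v"
  using assms(2) rtranclp_mono[of "adj G" "adj H"] assms(1) by (auto simp: le_fun_def)

lemma adj_delete_vertex: "adj (delete_vertex G w) u v \<longleftrightarrow> adj G u v \<and> u \<noteq> w \<and> v \<noteq> w"
  by (auto simp: delete_vertex_def adj_def)

lemma simple_graph_eqI:
  assumes "simple_graph G" "simple_graph H" "verts G = verts H"
    and "\<And>u v. adj G u v \<longleftrightarrow> adj H u v"
  shows "G = H"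
proof -
  have "e \<in> edges G \<longleftrightarrow> e \<in> edges H" for e
  proof (cases "card e = 2")
    case True
    then obtain u v where "e = {u, v}" by (auto simp: card_2_iff)
    then show ?thesis using assms(4)[of u v] by (simp add: adj_def)
  next
    case False
    then show ?thesis using assms(1,2) by (auto simp: simple_graph_def)
  qed
  then show ?thesis using assms(3) by (metis graph.expand set_eqI)
qed

definition induced :: "'a graph \<Rightarrow> 'a set \<Rightarrow> 'a graph" where
  "induced G W = Graph W {e \<in> edges G. e \<subseteq> W}"

lemma verts_induced [simp]: "verts (induced G W) = W"
  by (simp add: induced_def)

lemma adj_induced: "adj (induced G W) u v \<longleftrightarrow> adj G u v \<and> u \<in> W \<and> v \<in> W"
  by (auto simp: induced_def adj_def)

lemma induced_subgraph:
  assumes "simple_graph G" "W \<subseteq> verts G"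
  shows "subgraph (induced G W) G" "simple_graph (induced G W)"
  using assms finite_subset by (auto simp: subgraph_def simple_graph_def induced_def)

definition complete_on :: "'a set \<Rightarrow> 'a graph" where
  "complete_on W = Graph W {e. e \<subseteq> W \<and> card e = 2}"

lemma verts_complete_on [simp]: "verts (complete_on W) = W"
  by (simp add: complete_on_def)

lemma adj_complete_on: "adj (complete_on W) u v \<longleftrightarrow> u \<in> W \<and> v \<in> W \<and> u \<noteq> v"
  by (auto simp: complete_on_def adj_def card_insert_if)

lemma complete_complete_on: "finite W \<Longrightarrow> W \<noteq> {} \<Longrightarrow> complete_graph (complete_on W)"
  by (auto simp: complete_graph_def simple_graph_def adj_complete_on)
     (auto simp: complete_on_def)

lemma complete_graph_adj:
  "complete_graph G \<Longrightarrow> adj G u v \<longleftrightarrow> u \<in> verts G \<and> v \<in> verts G \<and> u \<noteq> v"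
  using adjD[of G u v] by (auto simp: complete_graph_def)

definition clique :: "'a graph \<Rightarrow> 'a set \<Rightarrow> bool" where
  "clique G Q \<longleftrightarrow> Q \<subseteq> verts G \<and> (\<forall>u \<in> Q. \<forall>v \<in> Q. u \<noteq> v \<longrightarrow> adj G u v)"

text \<open>Maximality is tested by single vertices, which suffices because a larger clique would
  contribute one. The empty set qualifies only in a graph without vertices.\<close>

definition maximal_clique :: "'a graph \<Rightarrow> 'a set \<Rightarrow> bool" where
  "maximal_clique G Q \<longleftrightarrow>
     clique G Q \<and> (\<forall>w \<in> verts G. (\<forall>q \<in> Q. w \<noteq> q \<longrightarrow> adj G w q) \<longrightarrow> w \<in> Q)"

text \<open>Stands in for a perfect block-cover on the level of vertex sets, so that edge sets of
  blocks need not be carried along.\<close>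

definition clique_cover :: "'a graph \<Rightarrow> 'a set set \<Rightarrow> bool" where
  "clique_cover G P \<longleftrightarrow>
     (\<forall>Q \<in> P. maximal_clique G Q) \<and> pairwise disjnt P \<and> verts G \<subseteq> \<Union>P"

lemma clique_adj: "clique G Q \<Longrightarrow> u \<in> Q \<Longrightarrow> v \<in> Q \<Longrightarrow> u \<noteq> v \<Longrightarrow> adj G u v"
  by (auto simp: clique_def)

lemma maximal_clique_in:
  "maximal_clique G Q \<Longrightarrow> w \<in> verts G \<Longrightarrow> (\<And>q. q \<in> Q \<Longrightarrow> w \<noteq> q \<Longrightarrow> adj G w q) \<Longrightarrow> w \<in> Q"
  by (auto simp: maximal_clique_def)

lemma clique_complete_on_subgraph:
  assumes "simple_graph G" "clique G Q"
  shows "subgraph (complete_on Q) G"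
proof -
  have fin: "finite Q"
    using assms finite_subset by (auto simp: clique_def simple_graph_def)
  have "e \<in> edges G" if eQ: "e \<subseteq> Q" "card e = 2" for e
  proof -
    obtain u v where e: "e = {u, v}" "u \<noteq> v" using eQ(2) unfolding card_2_iff by blast
    then have "adj G u v" using eQ(1) assms(2) by (simp add: clique_def)
    then show ?thesis using e by (simp add: adj_def)
  qed
  then show ?thesis
    using assms(2) fin by (auto simp: subgraph_def clique_def simple_graph_def complete_on_def)
qed

subsection \<open>Blocks of a block graph\<close>

lemma card_components_le_1:
  assumes "\<And>u v. u \<in> verts G \<Longrightarrow> v \<in> verts G \<Longrightarrow> (adj G)\<^sup>*\<^sup>* u v"
  shows "card (components G) \<le> 1"
proof -
  have "components G \<subseteq> {verts G}" using assms by (auto simp: components_def)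
  then show ?thesis using card_mono[of "{verts G}" "components G"] by simp
qed

text \<open>After the deletion of \<open>w\<close> at most one component is left, and a nonempty
  graph has at least one, so the number of components cannot grow.\<close>

lemma no_cut_vertexI:
  assumes "simple_graph G" "verts G \<noteq> {}"
    and "\<And>w u v. w \<in> verts G \<Longrightarrow> u \<in> verts G \<Longrightarrow> v \<in> verts G \<Longrightarrow> u \<noteq> w \<Longrightarrow> v \<noteq> w \<Longrightarrow>
           (adj (delete_vertex G w))\<^sup>*\<^sup>* u v"
  shows "\<nexists>w. cut_vertex G w"
proof
  assume "\<exists>w. cut_vertex G w"
  then obtain w where w: "w \<in> verts G" "card (components G) < card (components (delete_vertex G w))"
    by (auto simp: cut_vertex_def)
  have "card (components (delete_vertex G w)) \<le> 1"
    using assms(3) w(1) by (intro card_components_le_1) (auto simp: delete_vertex_def)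
  moreover have "card (components G) \<noteq> 0"
    using assms(1,2) by (auto simp: components_def simple_graph_def)
  ultimately show False using w(2) by simp
qed

lemma complete_graph_connected: "complete_graph G \<Longrightarrow> connected_graph G"
  unfolding connected_graph_def complete_graph_def by (metis r_into_rtranclp rtranclp.rtrancl_refl)

lemma complete_graph_no_cut_vertex:
  assumes "complete_graph G"
  shows "\<nexists>w. cut_vertex G w"
proof (rule no_cut_vertexI)
  fix w u v assume "u \<in> verts G" "v \<in> verts G" "u \<noteq> w" "v \<noteq> w"
  then show "(adj (delete_vertex G w))\<^sup>*\<^sup>* u v"
    using assms by (cases "u = v") (auto simp: complete_graph_def adj_delete_vertex)
qed (use assms in \<open>auto simp: complete_graph_def\<close>)

lemma simple_graph_finite_edges: "simple_graph G \<Longrightarrow> finite (edges G)"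
  by (rule finite_subset[of _ "Pow (verts G)"]) (auto simp: simple_graph_def)

lemma subgraph_trans: "subgraph A B \<Longrightarrow> subgraph B C \<Longrightarrow> subgraph A C"
  by (auto simp: subgraph_def)

text \<open>Among the competing subgraphs above \<open>B\<close>, one with the largest number of
  vertices plus edges is a block. Edges are counted as well because a larger subgraph may have the
  same vertices.\<close>

lemma ex_block_above:
  assumes "simple_graph G" "subgraph B G" "connected_graph B" "\<nexists>v. cut_vertex B v"
  shows "\<exists>B'. block G B' \<and> subgraph B B'"
proof -
  let ?P = "\<lambda>B'. subgraph B' G \<and> connected_graph B' \<and> (\<nexists>v. cut_vertex B' v) \<and> subgraph B B'"
  let ?m = "\<lambda>B'. card (verts B') + card (edges B')"
  have fin: "finite (verts G)" "finite (edges G)"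
    using assms(1) simple_graph_finite_edges by (auto simp: simple_graph_def)
  have "?P B" using assms by (auto simp: subgraph_def)
  moreover have "\<forall>B'. ?P B' \<longrightarrow> ?m B' < Suc (?m G)"
    using fin by (auto simp: subgraph_def less_Suc_eq_le intro!: add_mono card_mono)
  ultimately obtain M where M: "?P M" "\<And>B'. ?P B' \<Longrightarrow> ?m B' \<le> ?m M"
    using ex_has_greatest_nat[of ?P B ?m] by blast
  have "B' = M" if B': "subgraph B' G" "connected_graph B'" "\<nexists>v. cut_vertex B' v" "subgraph M B'" for B'
  proof -
    have le: "?m B' \<le> ?m M" using M B' subgraph_trans by blast
    have s: "verts M \<subseteq> verts B'" "edges M \<subseteq> edges B'" using B'(4) by (auto simp: subgraph_def)
    have f: "finite (verts B')" "finite (edges B')"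
      using B'(1) fin finite_subset by (auto simp: subgraph_def)
    have "card (verts M) \<le> card (verts B')" "card (edges M) \<le> card (edges B')"
      using s f by (auto intro: card_mono)
    then have "card (verts M) = card (verts B')" "card (edges M) = card (edges B')"
      using le by linarith+
    then have "verts M = verts B'" "edges M = edges B'" using s f card_subset_eq by blast+
    then show ?thesis by (simp add: graph.expand)
  qed
  then have "block G M" using M(1) unfolding block_def by blast
  then show ?thesis using M(1) by blast
qed

text \<open>\<open>B\<close> lies in a block, and that block is complete. Apart from simplicity, the
  block-graph hypothesis enters everything below through this fact.\<close>

lemma block_graph_nonseparable_clique:
  assumes "block_graph G" "subgraph B G" "connected_graph B" "\<nexists>v. cut_vertex B v"
  shows "clique G (verts B)"
proof -
  obtain B' where B': "block G B'" "subgraph B B'"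
    using ex_block_above assms by (metis block_graph_def)
  then have "complete_graph B'" "subgraph B' G"
    using assms(1) by (auto simp: block_graph_def block_def)
  then show ?thesis
    using B'(2) by (auto simp: clique_def complete_graph_def subgraph_def adj_def subset_iff)
qed

text \<open>A vertex \<open>w\<close> adjacent to all of \<open>B\<close> yields the complete graph
  on \<open>insert w (verts B)\<close>, which is connected, has no cut-vertex and contains
  \<open>B\<close>; maximality of the block makes it equal to \<open>B\<close>.\<close>

lemma block_maximal_clique:
  assumes "block_graph G" "block G B"
  shows "maximal_clique G (verts B)"
  unfolding maximal_clique_def
proof (intro conjI ballI impI)
  have sub: "subgraph B G" using assms(2) by (simp add: block_def)
  have cl: "clique G (verts B)"
    using block_graph_nonseparable_clique assms by (auto simp: block_def)
  then show "clique G (verts B)" .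
  fix w assume w: "w \<in> verts G" "\<forall>q\<in>verts B. w \<noteq> q \<longrightarrow> adj G w q"
  let ?W = "insert w (verts B)"
  have G: "simple_graph G" using assms(1) by (simp add: block_graph_def)
  have "clique G ?W" using cl w by (auto simp: clique_def adj_sym)
  then have s: "subgraph (complete_on ?W) G" using clique_complete_on_subgraph G by blast
  have "complete_graph (complete_on ?W)"
    using s by (intro complete_complete_on) (auto simp: subgraph_def simple_graph_def)
  moreover have "subgraph B (complete_on ?W)"
    using sub by (auto simp: subgraph_def complete_on_def simple_graph_def)
  ultimately have "complete_on ?W = B"
    using s assms(2) complete_graph_connected complete_graph_no_cut_vertex unfolding block_def by blast
  then show "w \<in> verts B" using verts_complete_on by (metis insertI1)
qed

text \<open>A connected subgraph without cut-vertices above \<open>complete_on Q\<close> is spanned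
  by a clique, so it has no vertex outside \<open>Q\<close>, and \<open>complete_on Q\<close>
  already has every possible edge.\<close>

lemma maximal_clique_block:
  assumes "block_graph G" "maximal_clique G Q" "Q \<noteq> {}"
  shows "block G (complete_on Q)"
proof -
  have G: "simple_graph G" using assms(1) by (simp add: block_graph_def)
  have cl: "clique G Q" using assms(2) by (simp add: maximal_clique_def)
  have s: "subgraph (complete_on Q) G" using clique_complete_on_subgraph G cl by blast
  have comp: "complete_graph (complete_on Q)"
    using s assms(3) by (intro complete_complete_on) (auto simp: subgraph_def simple_graph_def)
  have "B = complete_on Q"
    if B: "subgraph B G" "connected_graph B" "\<nexists>v. cut_vertex B v" "subgraph (complete_on Q) B" for B
  proof -
    have clB: "clique G (verts B)" using block_graph_nonseparable_clique assms(1) B by blast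
    have "Q \<subseteq> verts B" using B(4) by (auto simp: subgraph_def)
    then have "verts B = Q"
      using clB assms(2) by (auto simp: maximal_clique_def clique_def subset_iff)
    moreover have "edges B \<subseteq> edges (complete_on Q)"
      using B(1) \<open>verts B = Q\<close> by (auto simp: subgraph_def simple_graph_def complete_on_def)
    ultimately show ?thesis using B(4) by (simp add: graph.expand subgraph_def)
  qed
  then show ?thesis
    using s comp complete_graph_connected complete_graph_no_cut_vertex unfolding block_def by blast
qed

lemma perfect_block_cover_iff_clique_cover:
  assumes "block_graph G"
  shows "(\<exists>\<P>. perfect_block_cover G \<P>) \<longleftrightarrow> (\<exists>P. clique_cover G P)"
proof
  assume "\<exists>\<P>. perfect_block_cover G \<P>"
  then obtain \<P> where P: "perfect_block_cover G \<P>" by blast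
  then have "clique_cover G (verts ` \<P>)"
    using block_maximal_clique[OF assms]
    by (fastforce simp: perfect_block_cover_def clique_cover_def pairwise_def)
  then show "\<exists>P. clique_cover G P" by blast
next
  assume "\<exists>P. clique_cover G P"
  then obtain P where P: "clique_cover G P" by blast
  \<comment> \<open>The empty set is dropped because it spans no block; it covers nothing.\<close>
  have "perfect_block_cover G (complete_on ` (P - {{}}))"
    using P maximal_clique_block[OF assms]
    by (auto simp: perfect_block_cover_def clique_cover_def pairwise_def)
  then show "\<exists>\<P>. perfect_block_cover G \<P>" by blast
qed

section \<open>From block graphs to linked neighbours\<close>

definition clique_linked :: "'a graph \<Rightarrow> bool" where
  "clique_linked G \<longleftrightarrow>
     (\<forall>u a b. adj G u a \<and> adj G u b \<and> a \<noteq> b \<and> (adj (delete_vertex G u))\<^sup>*\<^sup>* a b \<longrightarrow> adj G a b)"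

text \<open>A smallest set \<open>C\<close> that links \<open>a\<close> and \<open>b\<close> plays the role of a shortest path: together
  with a common neighbour of \<open>a\<close> and \<open>b\<close> it spans a subgraph without cut-vertices.\<close>

lemma minimal_link_delete:
  assumes "finite C" "(adj (induced G C))\<^sup>*\<^sup>* a b" "a \<in> C" "b \<in> C"
    and min: "\<And>C'. C' \<subset> C \<Longrightarrow> a \<in> C' \<Longrightarrow> b \<in> C' \<Longrightarrow> \<not> (adj (induced G C'))\<^sup>*\<^sup>* a b"
    and z: "z \<in> C" "z \<noteq> x"
  shows "\<exists>t \<in> {a, b} - {x}. (adj (induced G (C - {x})))\<^sup>*\<^sup>* z t"
proof (rule ccontr)
  assume neg: "\<not> ?thesis"
  \<comment> \<open>\<open>Z\<close> is the component of \<open>z\<close> in \<open>C - {x}\<close>.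
    If it misses both \<open>a\<close> and \<open>b\<close>, it can be cut out of \<open>C\<close>
    without breaking the link, against minimality.\<close>
  define Z where "Z = {w \<in> C - {x}. (adj (induced G (C - {x})))\<^sup>*\<^sup>* z w}"
  have ab: "a \<notin> Z" "b \<notin> Z" using neg by (auto simp: Z_def)
  have x: "x \<notin> Z" by (simp add: Z_def)
  \<comment> \<open>Every edge that leaves \<open>Z\<close> inside \<open>C\<close> ends in
    \<open>x\<close>.\<close>
  have bd: "q = x" if "adj (induced G C) p q" "p \<in> Z" "q \<notin> Z" for p q
  proof (rule ccontr)
    assume "q \<noteq> x"
    then have "adj (induced G (C - {x})) p q" using that by (auto simp: adj_induced Z_def)
    then have "q \<in> Z"
      using that \<open>q \<noteq> x\<close> by (auto simp: Z_def adj_induced intro: rtranclp.rtrancl_into_rtrancl)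
    then show False using that by simp
  qed
  \<comment> \<open>Induction along the walk from \<open>a\<close>. It enters and leaves
    \<open>Z\<close> only through \<open>x\<close>, so during a visit to \<open>Z\<close> it is
    enough to remember a walk to \<open>x\<close> outside \<open>Z\<close>.\<close>
  have "if w \<in> Z then (adj (induced G (C - Z)))\<^sup>*\<^sup>* a x else (adj (induced G (C - Z)))\<^sup>*\<^sup>* a w"
    if "(adj (induced G C))\<^sup>*\<^sup>* a w" for w
    using that
  proof (induction rule: rtranclp_induct)
    case base
    then show ?case using ab by simp
  next
    case (step p q)
    have sym: "adj (induced G C) q p" using step.hyps(2) adj_sym by metis
    consider "p \<in> Z" "q \<in> Z" | "p \<in> Z" "q \<notin> Z" | "p \<notin> Z" "q \<in> Z" | "p \<notin> Z" "q \<notin> Z" by blast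
    then show ?case
    proof cases
      case 2
      then show ?thesis using bd step by auto
    next
      case 3
      then show ?thesis using bd[OF sym] step by auto
    next
      case 4
      then have "adj (induced G (C - Z)) p q" using step.hyps(2) by (auto simp: adj_induced)
      then show ?thesis using step.IH 4 by (auto intro: rtranclp.rtrancl_into_rtrancl)
    qed (use step in simp)
  qed
  then have "(adj (induced G (C - Z)))\<^sup>*\<^sup>* a b" using assms(2) ab by force
  moreover have "z \<in> Z" using z by (simp add: Z_def)
  ultimately show False
    using min[of "C - Z"] ab assms(3,4) z by blast
qed

text \<open>For a smallest link \<open>C\<close> avoiding \<open>u\<close>, the graph induced on
  \<open>insert u C\<close> stays connected when any one vertex is deleted. It is therefore a
  clique, and it contains \<open>a\<close> and \<open>b\<close>.\<close>

lemma block_graph_clique_linked: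
  assumes "block_graph G"
  shows "clique_linked G"
  unfolding clique_linked_def
proof (intro allI impI, elim conjE)
  fix u a b
  assume u: "adj G u a" "adj G u b" "a \<noteq> b" and link: "(adj (delete_vertex G u))\<^sup>*\<^sup>* a b"
  have G: "simple_graph G" using assms by (simp add: block_graph_def)
  let ?L = "\<lambda>C. a \<in> C \<and> b \<in> C \<and> C \<subseteq> verts G - {u} \<and> (adj (induced G C))\<^sup>*\<^sup>* a b"
  have "(adj (induced G (verts G - {u})))\<^sup>*\<^sup>* a b"
    by (rule adj_rtranclp_mono[OF _ link]) (use adjD[OF G] in \<open>auto simp: adj_induced adj_delete_vertex\<close>)
  then have L: "?L (verts G - {u})"
    using adjD[OF G u(1)] adjD[OF G u(2)] by auto
  obtain C where C: "?L C" and min: "\<And>C'. ?L C' \<Longrightarrow> card C \<le> card C'"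
    using ex_has_least_nat[of ?L, OF L, of card] by (elim exE conjE) simp
  have fin: "finite C" using C G finite_subset by (auto simp: simple_graph_def)
  have del: "\<exists>t \<in> {a, b} - {x}. (adj (induced G (C - {x})))\<^sup>*\<^sup>* z t" if "z \<in> C" "z \<noteq> x" for x z
  proof (rule minimal_link_delete[OF fin])
    fix C' assume "C' \<subset> C" "a \<in> C'" "b \<in> C'"
    then show "\<not> (adj (induced G C'))\<^sup>*\<^sup>* a b"
      using min[of C'] C psubset_card_mono[OF fin] by (metis leD psubset_imp_subset subset_trans)
  qed (use C that in auto)
  let ?B = "induced G (insert u C)"
  have sub: "subgraph ?B G" "simple_graph ?B"
    using induced_subgraph[OF G, of "insert u C"] C u adjD[OF G] by blast+
  have uC: "u \<notin> C" using C by blast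
  \<comment> \<open>Without \<open>x\<close>, the vertex \<open>z\<close> still reaches
    \<open>a\<close> or \<open>b\<close>, whichever end survives, and both are neighbours of
    \<open>u\<close>.\<close>
  have del_B: "(adj (delete_vertex ?B x))\<^sup>*\<^sup>* u z" if "z \<in> C" "z \<noteq> x" "x \<noteq> u" for x z
  proof -
    obtain t where t: "t \<in> {a, b} - {x}" "(adj (induced G (C - {x})))\<^sup>*\<^sup>* z t"
      using del \<open>z \<in> C\<close> \<open>z \<noteq> x\<close> by blast
    have zt: "(adj (delete_vertex ?B x))\<^sup>*\<^sup>* z t"
      by (rule adj_rtranclp_mono[OF _ t(2)]) (auto simp: adj_induced adj_delete_vertex)
    have "adj (delete_vertex ?B x) u t"
      using t(1) u C that by (auto simp: adj_induced adj_delete_vertex)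
    then show ?thesis
      using adj_rtranclp_sym[OF zt] by (rule converse_rtranclp_into_rtranclp)
  qed
  \<comment> \<open>Applied with the deleted vertex \<open>u\<close> outside \<open>C\<close>,
    \<open>del\<close> says that every \<open>z\<close> reaches \<open>a\<close> or \<open>b\<close>
    within \<open>C\<close>; the link joins these two.\<close>
  have con_C: "(adj (delete_vertex ?B u))\<^sup>*\<^sup>* a z" if z: "z \<in> C" for z
  proof -
    have "z \<noteq> u" using z uC by blast
    then have "\<exists>t \<in> {a, b} - {u}. (adj (induced G (C - {u})))\<^sup>*\<^sup>* z t" by (rule del[OF z])
    moreover have m: "(adj (delete_vertex ?B u))\<^sup>*\<^sup>* p q" if "(adj (induced G C))\<^sup>*\<^sup>* p q" for p q
      by (rule adj_rtranclp_mono[OF _ that]) (use uC in \<open>auto simp: adj_induced adj_delete_vertex\<close>)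
    moreover have "C - {u} = C" using uC by blast
    ultimately have "(adj (delete_vertex ?B u))\<^sup>*\<^sup>* z a \<or> (adj (delete_vertex ?B u))\<^sup>*\<^sup>* z b" by auto
    then show ?thesis using m[of a b] C adj_rtranclp_sym rtranclp_trans by metis
  qed
  have "connected_graph ?B"
    unfolding connected_graph_def
  proof (intro conjI ballI)
    have "(adj ?B)\<^sup>*\<^sup>* a z" if "z \<in> verts ?B" for z
    proof (cases "z = u")
      case True
      then have "adj ?B a z" using u(1) C by (simp add: adj_induced adj_sym)
      then show ?thesis by blast
    next
      case False
      then show ?thesis
        using con_C[of z] adj_rtranclp_mono[of "delete_vertex ?B u" ?B] that
        by (auto simp: adj_delete_vertex)
    qed
    then show "(adj ?B)\<^sup>*\<^sup>* p q" if "p \<in> verts ?B" "q \<in> verts ?B" for p q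
      using that by (meson adj_rtranclp_sym rtranclp_trans)
  qed auto
  moreover have "\<nexists>x. cut_vertex ?B x"
  proof (rule no_cut_vertexI[OF sub(2)])
    fix x p q assume pq: "p \<in> verts ?B" "q \<in> verts ?B" "p \<noteq> x" "q \<noteq> x"
    show "(adj (delete_vertex ?B x))\<^sup>*\<^sup>* p q"
    proof (cases "x = u")
      case True
      then show ?thesis using con_C pq by (metis adj_rtranclp_sym insertE rtranclp_trans verts_induced)
    next
      case False
      have "(adj (delete_vertex ?B x))\<^sup>*\<^sup>* u r" if "r \<in> verts ?B" "r \<noteq> x" for r
        using del_B[of r x] that False by (cases "r = u") auto
      then show ?thesis using pq by (meson adj_rtranclp_sym rtranclp_trans)
    qed
  qed auto
  ultimately have "clique G (insert u C)"
    using block_graph_nonseparable_clique[OF assms sub(1)] by simp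
  then show "adj G a b" using C u by (auto simp: clique_def)
qed


subsection \<open>Attaching a corona\<close>

text \<open>Of \<open>G'\<close> only simplicity is asked, so that the same facts serve to build
  members of the family and to take a corona off a graph whose membership is still open.\<close>

locale corona_attachment =
  fixes G' :: "'a graph" and v :: 'a and K :: "'a graph" and H :: "'a \<Rightarrow> 'a graph"
  assumes simple: "simple_graph G'" and v: "v \<in> verts G'" and corona: "corona_family K H"
    and disj: "disjnt (verts G') (verts (general_corona K H))"
begin

abbreviation G :: "'a graph" where
  "G \<equiv> attach G' v (general_corona K H) (verts K)"

lemma verts_G: "verts G = verts G' \<union> (verts K \<union> (\<Union>x \<in> verts K. verts (H x)))"
  by (simp add: attach_def general_corona_def)

lemma body_new: "x \<in> verts K \<Longrightarrow> x \<notin> verts G'"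
  using disj by (auto simp: disjnt_def general_corona_def)

lemma leaf_new: "x \<in> verts K \<Longrightarrow> h \<in> verts (H x) \<Longrightarrow> h \<notin> verts G'"
  using disj by (auto simp: disjnt_def general_corona_def)

lemma leaf_not_body: "x \<in> verts K \<Longrightarrow> h \<in> verts (H x) \<Longrightarrow> h \<notin> verts K"
  using corona by (auto simp: corona_family_def disjnt_def)

lemma leaf_unique:
  "x \<in> verts K \<Longrightarrow> y \<in> verts K \<Longrightarrow> h \<in> verts (H x) \<Longrightarrow> h \<in> verts (H y) \<Longrightarrow> x = y"
  using corona unfolding corona_family_def disjnt_def by blast

lemma complete_K: "complete_graph K"
  using corona by (simp add: corona_family_def)

lemma complete_H: "x \<in> verts K \<Longrightarrow> complete_graph (H x)"
  using corona by (simp add: corona_family_def)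

lemma finite_K: "finite (verts K)" and K_nonempty: "verts K \<noteq> {}"
  using complete_K by (auto simp: complete_graph_def simple_graph_def)

lemma finite_H: "x \<in> verts K \<Longrightarrow> finite (verts (H x))"
  and H_nonempty: "x \<in> verts K \<Longrightarrow> verts (H x) \<noteq> {}"
  using complete_H by (auto simp: complete_graph_def simple_graph_def)

text \<open>Completeness of the body and of the leaf graphs replaces their edge sets by membership
  and inequality, so later arguments refer to vertex sets only.\<close>

lemma adj_G_iff:
  "adj G a b \<longleftrightarrow> adj G' a b \<or> (a \<in> verts K \<and> b \<in> verts K \<and> a \<noteq> b) \<or>
     (\<exists>x \<in> verts K. a \<in> verts (H x) \<and> b \<in> verts (H x) \<and> a \<noteq> b) \<or>
     (a \<in> verts K \<and> b \<in> verts (H a)) \<or> (b \<in> verts K \<and> a \<in> verts (H b)) \<or>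
     (a = v \<and> b \<in> verts K) \<or> (b = v \<and> a \<in> verts K)"
proof -
  have "adj G a b \<longleftrightarrow> adj G' a b \<or> adj K a b \<or> (\<exists>x \<in> verts K. adj (H x) a b) \<or>
     (\<exists>x y. {a, b} = {x, y} \<and> x \<in> verts K \<and> y \<in> verts (H x)) \<or> (\<exists>w \<in> verts K. {a, b} = {v, w})"
    unfolding attach_def general_corona_def adj_def by auto
  then show ?thesis
    using complete_graph_adj[OF complete_K] complete_graph_adj[OF complete_H]
    by (auto simp: doubleton_eq_iff)
qed

lemma simple_G: "simple_graph G"
proof -
  have "e \<subseteq> verts G \<and> card e = 2" if "e \<in> edges G" for e
  proof -
    consider "e \<in> edges G'" | "e \<in> edges K" | x where "x \<in> verts K" "e \<in> edges (H x)"
      | x y where "e = {x, y}" "x \<in> verts K" "y \<in> verts (H x)" | w where "w \<in> verts K" "e = {v, w}"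
      using \<open>e \<in> edges G\<close> unfolding attach_def general_corona_def by auto
    then show ?thesis
    proof cases
      case 1
      then show ?thesis using simple by (auto simp: verts_G simple_graph_def)
    next
      case 2
      then show ?thesis using complete_K by (auto simp: verts_G complete_graph_def simple_graph_def)
    next
      case 3
      then show ?thesis
        using complete_H[OF 3(1)] by (auto simp: verts_G complete_graph_def simple_graph_def)
    next
      case 4
      then show ?thesis using leaf_not_body[OF 4(2,3)] by (auto simp: verts_G card_insert_if)
    next
      case 5
      then show ?thesis using v body_new[OF 5(1)] by (auto simp: verts_G card_insert_if)
    qed
  qed
  moreover have "finite (verts G)"
    unfolding verts_G using simple finite_K finite_H by (auto simp: simple_graph_def)
  ultimately show ?thesis by (auto simp: simple_graph_def)
qed

lemma adj_old: "a \<in> verts G' \<Longrightarrow> b \<in> verts G' \<Longrightarrow> adj G a b \<longleftrightarrow> adj G' a b"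
  using body_new leaf_new by (auto simp: adj_G_iff)

lemma adj_leaf:
  assumes "x \<in> verts K" "a \<in> verts (H x)"
  shows "adj G a b \<longleftrightarrow> b = x \<or> (b \<in> verts (H x) \<and> b \<noteq> a)"
  using assms body_new leaf_new leaf_not_body leaf_unique v adjD(1)[OF simple]
  unfolding adj_G_iff by metis

lemma adj_old_new:
  assumes "a \<in> verts G'" "adj G a b" "b \<notin> verts G'"
  shows "a = v \<and> b \<in> verts K"
  using assms body_new leaf_new adjD(2)[OF simple] unfolding adj_G_iff by blast

lemma card_verts_less: "card (verts G') < card (verts G)"
proof (rule psubset_card_mono)
  show "finite (verts G)" using simple_G by (simp add: simple_graph_def)
  show "verts G' \<subset> verts G" using K_nonempty body_new unfolding verts_G by blast
qed

lemma connected_G':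
  assumes "connected_graph G"
  shows "connected_graph G'"
proof -
  have "a \<in> verts G' \<longrightarrow> (adj G')\<^sup>*\<^sup>* v a" if "(adj G)\<^sup>*\<^sup>* v a" for a
    using that
  proof (induction rule: rtranclp_induct)
    case (step a b)
    show ?case
    proof
      assume b: "b \<in> verts G'"
      show "(adj G')\<^sup>*\<^sup>* v b"
      proof (cases "a \<in> verts G'")
        case True
        then have "adj G' a b" using step.hyps adj_old b by simp
        then show ?thesis using step.IH True by (auto intro: rtranclp.rtrancl_into_rtrancl)
      next
        case False
        then have "b = v" using adj_old_new[OF b, of a] step.hyps adj_sym by metis
        then show ?thesis by simp
      qed
    qed
  qed simp
  then have "(adj G')\<^sup>*\<^sup>* v a" if "a \<in> verts G'" for a
    using assms v that by (auto simp: connected_graph_def verts_G)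
  then show ?thesis
    unfolding connected_graph_def using v by (metis adj_rtranclp_sym empty_iff rtranclp_trans)
qed

lemma clique_linked_G':
  assumes "clique_linked G"
  shows "clique_linked G'"
  unfolding clique_linked_def
proof (intro allI impI, elim conjE)
  fix u a b
  assume h: "adj G' u a" "adj G' u b" "a \<noteq> b" "(adj (delete_vertex G' u))\<^sup>*\<^sup>* a b"
  have "(adj (delete_vertex G u))\<^sup>*\<^sup>* a b"
    by (rule adj_rtranclp_mono[OF _ h(4)]) (auto simp: adj_delete_vertex adj_G_iff)
  moreover have "adj G u a" "adj G u b" using h by (auto simp: adj_G_iff)
  ultimately have "adj G a b" using assms h(3) unfolding clique_linked_def by blast
  then show "adj G' a b" using adj_old adjD[OF simple] h by metis
qed

section \<open>Independent sets under the attachment of a corona\<close>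

lemma independent_restrict: "independent_set G S \<Longrightarrow> independent_set G' (S \<inter> verts G')"
  by (auto simp: independent_set_def adj_G_iff)

text \<open>The sets \<open>insert x (verts (H x))\<close> are cliques that cover the new vertices,
  and an independent set takes at most one vertex from each.\<close>

lemma card_independent_le:
  assumes "independent_set G S"
  shows "card S \<le> card (S \<inter> verts G') + card (verts K)"
proof -
  let ?N = "\<lambda>x. S \<inter> insert x (verts (H x))"
  have "card (?N x) \<le> 1" if "x \<in> verts K" for x
  proof -
    have "p = q" if "p \<in> ?N x" "q \<in> ?N x" for p q
      using assms that \<open>x \<in> verts K\<close> by (auto simp: independent_set_def adj_G_iff)
    then show ?thesis using finite_H[OF \<open>x \<in> verts K\<close>] card_le_Suc0_iff_eq[of "?N x"] by auto
  qed
  then have "(\<Sum>x \<in> verts K. card (?N x)) \<le> card (verts K)"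
    using sum_mono[of "verts K" "\<lambda>x. card (?N x)" "\<lambda>_. 1"] by simp
  then have le: "card (\<Union>x \<in> verts K. ?N x) \<le> card (verts K)"
    using card_UN_le[OF finite_K, of ?N] by linarith
  have "S = (S \<inter> verts G') \<union> (\<Union>x \<in> verts K. ?N x)"
    using assms unfolding independent_set_def verts_G by blast
  then have "card S \<le> card (S \<inter> verts G') + card (\<Union>x \<in> verts K. ?N x)"
    using card_Un_le by metis
  then show ?thesis using le by linarith
qed

text \<open>One vertex is chosen from each clique \<open>insert x (verts (H x))\<close>: a leaf
  everywhere, except that a single body vertex may be chosen if \<open>v\<close> is outside
  \<open>T\<close>.\<close>

definition selection :: "'a set \<Rightarrow> ('a \<Rightarrow> 'a) \<Rightarrow> bool" where
  "selection T f \<longleftrightarrow>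
     (\<forall>x \<in> verts K. f x \<in> verts (H x) \<or>
        f x = x \<and> v \<notin> T \<and> (\<forall>y \<in> verts K. y \<noteq> x \<longrightarrow> f y \<in> verts (H y)))"

text \<open>An edge between two of the cliques joins body vertices, and an edge from an old to a new
  vertex joins \<open>v\<close> to a body vertex. A selection excludes both.\<close>

lemma independent_extend:
  assumes T: "independent_set G' T" and f: "selection T f"
  shows "independent_set G (T \<union> f ` verts K)" "card (T \<union> f ` verts K) = card T + card (verts K)"
proof -
  have TV: "T \<subseteq> verts G'" using T by (simp add: independent_set_def)
  have fx: "f x \<in> insert x (verts (H x))" if "x \<in> verts K" for x
    using f that by (auto simp: selection_def)
  have new: "f x \<notin> verts G'" if "x \<in> verts K" for x
    using fx[OF that] that body_new leaf_new by auto
  have inj: "inj_on f (verts K)"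
  proof (rule inj_onI)
    fix x y assume "x \<in> verts K" "y \<in> verts K" "f x = f y"
    then show "x = y" using fx[of x] fx[of y] leaf_not_body leaf_unique by (metis insertE)
  qed
  have a1: "\<not> adj G p q" if "p \<in> T" "q \<in> T" for p q
    using T TV that adj_old[of p q] by (auto simp: independent_set_def)
  have a2: "\<not> adj G p (f x)" if "p \<in> T" "x \<in> verts K" for p x
  proof
    assume "adj G p (f x)"
    then have "p = v \<and> f x \<in> verts K" using adj_old_new new TV that by blast
    then show False using f that leaf_not_body unfolding selection_def by blast
  qed
  have a3: "\<not> adj G (f x) (f y)" if xy: "x \<in> verts K" "y \<in> verts K" for x y
  proof (cases "x = y")
    case True
    then show ?thesis using adjD(3)[OF simple_G] by blast
  next
    case False
    then have "f x \<in> verts (H x) \<or> f y \<in> verts (H y)" using f xy unfolding selection_def by metis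
    then show ?thesis
    proof
      assume "f x \<in> verts (H x)"
      then show ?thesis
        using adj_leaf[OF xy(1), of "f x" "f y"] fx[OF xy(2)] xy False leaf_unique leaf_not_body
        by (metis insertE)
    next
      assume "f y \<in> verts (H y)"
      then show ?thesis
        using adj_leaf[OF xy(2), of "f y" "f x"] fx[OF xy(1)] xy False leaf_unique leaf_not_body
          adj_sym by (metis insertE)
    qed
  qed
  have "f x \<in> verts G" if "x \<in> verts K" for x
    using fx[OF that] that by (auto simp: verts_G)
  then have sub: "T \<union> f ` verts K \<subseteq> verts G" using TV by (auto simp: verts_G)
  show "independent_set G (T \<union> f ` verts K)"
    unfolding independent_set_def
  proof (intro conjI ballI)
    fix p q assume "p \<in> T \<union> f ` verts K" "q \<in> T \<union> f ` verts K"
    then show "\<not> adj G p q"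
      using a1 a2 a3 adj_sym[of G p q] by blast
  qed (rule sub)
  have "finite T" using TV simple finite_subset by (auto simp: simple_graph_def)
  then show "card (T \<union> f ` verts K) = card T + card (verts K)"
    using card_Un_disjoint[of T "f ` verts K"] card_image[OF inj] finite_K new TV by fastforce
qed

text \<open>The gain of \<open>card (verts K)\<close> by a selection meets the upper bound in
  \<open>card_independent_le\<close>.\<close>

lemma maximum_extend:
  assumes "maximum_independent_set G' T" "selection T f"
  shows "maximum_independent_set G (T \<union> f ` verts K)"
  unfolding maximum_independent_set_def
proof (intro conjI allI impI)
  have T: "independent_set G' T" "\<And>R. independent_set G' R \<Longrightarrow> card R \<le> card T"
    using assms by (auto simp: maximum_independent_set_def)
  show "independent_set G (T \<union> f ` verts K)" using independent_extend T assms by blast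
  fix R assume "independent_set G R"
  then show "card R \<le> card (T \<union> f ` verts K)"
    using card_independent_le[of R] T(2)[OF independent_restrict] independent_extend(2)[OF T(1) assms(2)]
    by fastforce
qed

lemma ex_leaves: "\<exists>f. \<forall>x \<in> verts K. f x \<in> verts (H x)"
  using H_nonempty by (intro bchoice) blast

text \<open>Old vertices and leaves are reached by selecting leaves. For a body vertex
  \<open>v\<close> must be avoided, which is why a maximum independent set through a neighbour
  \<open>w\<close> of \<open>v\<close> is taken.\<close>

lemma alpha_excellent_G:
  assumes exc: "alpha_excellent G'" and nbr: "\<exists>w. adj G' v w"
  shows "alpha_excellent G"
  unfolding alpha_excellent_def
proof
  fix u assume u: "u \<in> verts G"
  obtain f where f: "\<And>x. x \<in> verts K \<Longrightarrow> f x \<in> verts (H x)" using ex_leaves by blast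
  obtain w where w: "adj G' v w" using nbr by blast
  obtain T where T: "maximum_independent_set G' T" "w \<in> T"
    using exc adjD[OF simple w] by (auto simp: alpha_excellent_def)
  have vT: "v \<notin> T" using T w by (auto simp: maximum_independent_set_def independent_set_def)
  consider "u \<in> verts G'" | "u \<in> verts K" | x where "x \<in> verts K" "u \<in> verts (H x)"
    using u unfolding verts_G by blast
  then show "\<exists>S. maximum_independent_set G S \<and> u \<in> S"
  proof cases
    case 1
    then obtain T' where "maximum_independent_set G' T'" "u \<in> T'"
      using exc by (auto simp: alpha_excellent_def)
    then show ?thesis using maximum_extend[of T' f] f by (auto simp: selection_def)
  next
    case 2
    have "selection T (f(u := u))" using f vT by (auto simp: selection_def)
    then show ?thesis using maximum_extend[OF T(1)] 2 by (metis UnI2 fun_upd_same imageI)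
  next
    case 3
    have "selection T (f(x := u))" using f 3 by (auto simp: selection_def)
    then show ?thesis using maximum_extend[OF T(1)] 3 by (metis UnI2 fun_upd_same imageI)
  qed
qed

text \<open>The old part of a maximum independent set \<open>S\<close> is maximum: a larger
  \<open>R\<close> in \<open>G'\<close>, extended by one leaf for each body vertex, would exceed
  \<open>S\<close>.\<close>

lemma alpha_excellent_G':
  assumes "alpha_excellent G"
  shows "alpha_excellent G'"
  unfolding alpha_excellent_def
proof
  fix u assume u: "u \<in> verts G'"
  then obtain S where S: "maximum_independent_set G S" "u \<in> S"
    using assms verts_G by (auto simp: alpha_excellent_def)
  obtain f where f: "\<And>x. x \<in> verts K \<Longrightarrow> f x \<in> verts (H x)" using ex_leaves by blast
  have ind: "independent_set G S" using S by (simp add: maximum_independent_set_def)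
  have "card R \<le> card (S \<inter> verts G')" if R: "independent_set G' R" for R
  proof -
    have sel: "selection R f" using f by (simp add: selection_def)
    have "card R + card (verts K) \<le> card S"
      using independent_extend[OF R sel] S(1) unfolding maximum_independent_set_def by metis
    then show ?thesis using card_independent_le[OF ind] by linarith
  qed
  then have "maximum_independent_set G' (S \<inter> verts G')"
    using independent_restrict[OF ind] by (simp add: maximum_independent_set_def)
  then show "\<exists>S. maximum_independent_set G' S \<and> u \<in> S" using S(2) u by blast
qed

section \<open>Maximal cliques under the attachment of a corona\<close>

lemma maximal_clique_leaf:
  assumes x: "x \<in> verts K" and Q: "maximal_clique G Q" and h: "h \<in> Q" "h \<in> verts (H x)"
  shows "Q = insert x (verts (H x))"
proof
  have cl: "clique G Q" using Q by (simp add: maximal_clique_def)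
  show sub: "Q \<subseteq> insert x (verts (H x))"
  proof
    fix q assume "q \<in> Q"
    then have "q = h \<or> adj G h q" using clique_adj[OF cl h(1)] by metis
    then show "q \<in> insert x (verts (H x))" using h(2) by (auto simp: adj_leaf[OF x h(2)])
  qed
  show "insert x (verts (H x)) \<subseteq> Q"
  proof
    fix w assume w: "w \<in> insert x (verts (H x))"
    then have "adj G w q" if "q \<in> Q" "w \<noteq> q" for q
      using sub that x by (auto simp: adj_G_iff)
    moreover have "w \<in> verts G" using w x by (auto simp: verts_G)
    ultimately show "w \<in> Q" using maximal_clique_in[OF Q] by simp
  qed
qed

text \<open>A leaf of \<open>x\<close> has all its neighbours in this clique, so no further vertex
  is adjacent to all of it.\<close>

lemma maximal_clique_pendant:
  assumes x: "x \<in> verts K"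
  shows "maximal_clique G (insert x (verts (H x)))"
  unfolding maximal_clique_def
proof (intro conjI ballI impI)
  show "clique G (insert x (verts (H x)))"
    using x by (auto simp: clique_def verts_G adj_G_iff)
  fix w assume w: "\<forall>q\<in>insert x (verts (H x)). w \<noteq> q \<longrightarrow> adj G w q"
  obtain h where h: "h \<in> verts (H x)" using H_nonempty[OF x] by blast
  then have "w = h \<or> adj G h w" using w adj_sym[of G w h] by auto
  then show "w \<in> insert x (verts (H x))" using h by (auto simp: adj_leaf[OF x h])
qed

text \<open>The members inside \<open>G'\<close> suffice. A member with a new vertex
  \<open>z\<close> meets the clique of some body vertex and its leaves; the member covering one of
  these leaves is that whole clique, so by disjointness the two coincide and no old vertex is
  involved.\<close>

lemma clique_cover_G':
  assumes "clique_cover G P"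
  shows "\<exists>P'. clique_cover G' P'"
proof -
  have P: "\<And>Q. Q \<in> P \<Longrightarrow> maximal_clique G Q" "pairwise disjnt P" "verts G \<subseteq> \<Union>P"
    using assms by (auto simp: clique_cover_def)
  define P' where "P' = {Q \<in> P. Q \<subseteq> verts G'}"
  have "maximal_clique G' Q" if "Q \<in> P'" for Q
  proof -
    have Q: "maximal_clique G Q" "Q \<subseteq> verts G'" using that P by (auto simp: P'_def)
    show ?thesis
      unfolding maximal_clique_def
    proof (intro conjI ballI impI)
      show "clique G' Q" using Q adj_old by (auto simp: maximal_clique_def clique_def subset_iff)
      fix w assume w: "w \<in> verts G'" "\<forall>q\<in>Q. w \<noteq> q \<longrightarrow> adj G' w q"
      show "w \<in> Q"
        by (rule maximal_clique_in[OF Q(1)]) (use w in \<open>auto simp: verts_G adj_G_iff\<close>)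
    qed
  qed
  moreover have "pairwise disjnt P'" using P(2) by (auto simp: P'_def pairwise_def)
  moreover have "u \<in> \<Union>P'" if u: "u \<in> verts G'" for u
  proof -
    obtain Q where Q: "Q \<in> P" "u \<in> Q" using u P(3) verts_G by auto
    have "z \<in> verts G'" if z: "z \<in> Q" for z
    proof (rule ccontr)
      assume "z \<notin> verts G'"
      moreover have "z \<in> verts G"
        using P(1)[OF Q(1)] z by (auto simp: maximal_clique_def clique_def)
      ultimately obtain x where x: "x \<in> verts K" "z \<in> insert x (verts (H x))"
        unfolding verts_G by blast
      obtain h where h: "h \<in> verts (H x)" using H_nonempty[OF x(1)] by blast
      then have "h \<in> verts G" using x(1) by (auto simp: verts_G)
      then obtain R where R: "R \<in> P" "h \<in> R" using P(3) by blast
      have Req: "R = insert x (verts (H x))"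
        using maximal_clique_leaf[OF x(1) P(1)[OF R(1)] R(2) h] .
      then have "z \<in> R" using x by simp
      then have "R = Q" using P(2) R(1) Q(1) z unfolding pairwise_def disjnt_def by blast
      then show False using Req Q(2) u x(1) body_new leaf_new by auto
    qed
    then show ?thesis using Q by (auto simp: P'_def)
  qed
  ultimately have "clique_cover G' P'" by (auto simp: clique_cover_def)
  then show ?thesis by blast
qed

text \<open>The cliques formed by the body vertices and their leaves are added to \<open>P\<close>.
  It remains to see that no new vertex can enlarge an old member.\<close>

lemma clique_cover_G:
  assumes P: "clique_cover G' P" and nbr: "\<exists>w. adj G' v w"
  shows "\<exists>P. clique_cover G P"
proof -
  let ?P = "P \<union> (\<lambda>x. insert x (verts (H x))) ` verts K"
  have sub: "Q \<subseteq> verts G'" if "Q \<in> P" for Q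
    using that P by (auto simp: clique_cover_def maximal_clique_def clique_def)
  have "maximal_clique G Q" if QP: "Q \<in> P" for Q
  proof -
    have Q: "maximal_clique G' Q" using QP P by (simp add: clique_cover_def)
    show ?thesis
      unfolding maximal_clique_def
    proof (intro conjI ballI impI)
      show "clique G Q" using Q by (auto simp: maximal_clique_def clique_def verts_G adj_G_iff)
      fix w assume w: "w \<in> verts G" "\<forall>q\<in>Q. w \<noteq> q \<longrightarrow> adj G w q"
      have "w \<in> verts G'"
      proof (rule ccontr)
        assume w': "w \<notin> verts G'"
        \<comment> \<open>A new vertex is adjacent to no old vertex but \<open>v\<close>. A
          \<open>Q\<close> this small is not maximal in \<open>G'\<close>, since a neighbour
          \<open>z\<close> of \<open>v\<close> extends it, also when \<open>Q\<close> is
          empty.\<close>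
        have "Q \<subseteq> {v}"
        proof
          fix q assume q: "q \<in> Q"
          then have "w \<noteq> q" using w' sub[OF QP] by blast
          then have "adj G q w" using w(2) q adj_sym[of G q w] by simp
          then show "q \<in> {v}" using adj_old_new[of q w] w' sub[OF QP] q by blast
        qed
        moreover obtain z where z: "adj G' v z" using nbr by blast
        ultimately have "\<forall>q\<in>Q. z \<noteq> q \<longrightarrow> adj G' z q" using adj_sym[of G' z v] by auto
        then have "z \<in> Q" using maximal_clique_in[OF Q adjD(2)[OF simple z]] by simp
        then show False using \<open>Q \<subseteq> {v}\<close> adjD(3)[OF simple z] by blast
      qed
      then show "w \<in> Q"
        using maximal_clique_in[OF Q] w(2) adj_old sub[OF QP] by (metis subsetD)
    qed
  qed
  moreover have "pairwise disjnt ?P"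
  proof (rule pairwiseI)
    have pend: "disjnt Q (insert x (verts (H x)))" if "Q \<in> P" "x \<in> verts K" for Q x
      using sub[OF that(1)] that(2) body_new leaf_new by (auto simp: disjnt_def)
    have pend2: "disjnt (insert x (verts (H x))) (insert y (verts (H y)))"
      if "x \<in> verts K" "y \<in> verts K" "x \<noteq> y" for x y
      using that leaf_not_body leaf_unique by (auto simp: disjnt_def)
    fix A B assume "A \<in> ?P" "B \<in> ?P" "A \<noteq> B"
    then consider "A \<in> P" "B \<in> P" | x where "A \<in> P" "x \<in> verts K" "B = insert x (verts (H x))"
      | x where "B \<in> P" "x \<in> verts K" "A = insert x (verts (H x))"
      | x y where "x \<in> verts K" "A = insert x (verts (H x))" "y \<in> verts K" "B = insert y (verts (H y))"
      by blast
    then show "disjnt A B"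
    proof cases
      case 1
      then show ?thesis using P \<open>A \<noteq> B\<close> by (simp add: clique_cover_def pairwise_def)
    next
      case 2
      then show ?thesis using pend by simp
    next
      case 3
      then show ?thesis using disjnt_sym[OF pend] by simp
    next
      case 4
      then have "x \<noteq> y" using \<open>A \<noteq> B\<close> by blast
      then show ?thesis unfolding 4(2,4) by (rule pend2[OF 4(1,3)])
    qed
  qed
  moreover have "verts G \<subseteq> \<Union>?P" using P unfolding verts_G clique_cover_def by blast
  ultimately have "clique_cover G ?P"
    using maximal_clique_pendant unfolding clique_cover_def by blast
  then show ?thesis by blast
qed

end

subsection \<open>Levels of a clique-linked graph\<close>

text \<open>This is what the search for a corona takes from excellence or from a clique cover, so
  that one induction serves both.\<close>

definition no_private_pair :: "'a graph \<Rightarrow> bool" where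
  "no_private_pair G \<longleftrightarrow>
     (\<forall>x a b. adj G x a \<and> adj G x b \<and> a \<noteq> b \<and>
        (\<forall>z. adj G a z \<longrightarrow> z = x \<or> adj G x z) \<and> (\<forall>z. adj G b z \<longrightarrow> z = x \<or> adj G x z)
        \<longrightarrow> adj G a b)"

lemma no_private_pairD:
  assumes "no_private_pair G" "adj G x a" "adj G x b" "a \<noteq> b"
    and "\<And>z. adj G a z \<Longrightarrow> z = x \<or> adj G x z" "\<And>z. adj G b z \<Longrightarrow> z = x \<or> adj G x z"
  shows "adj G a b"
  using assms unfolding no_private_pair_def by blast

locale rooted_linked_graph =
  fixes G :: "'a graph" and r :: 'a
  assumes simple: "simple_graph G" and connected: "connected_graph G"
    and linked: "clique_linked G" and root: "r \<in> verts G"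
begin

text \<open>The distance from \<open>r\<close>; connectedness makes the set of lengths nonempty for
  every vertex of \<open>G\<close>.\<close>

definition level :: "'a \<Rightarrow> nat" where
  "level u = (LEAST n. (adj G ^^ n) r u)"

lemma level_le: "(adj G ^^ n) r u \<Longrightarrow> level u \<le> n"
  unfolding level_def by (rule Least_le)

lemma level_path:
  assumes "u \<in> verts G"
  shows "(adj G ^^ level u) r u"
proof -
  have "\<exists>n. (adj G ^^ n) r u"
    using connected root assms unfolding connected_graph_def rtranclp_power by blast
  then show ?thesis unfolding level_def by (rule LeastI_ex)
qed

lemma level_root [simp]: "level r = 0"
  using level_le[of 0 r] by simp

lemma level_0_iff: "u \<in> verts G \<Longrightarrow> level u = 0 \<longleftrightarrow> u = r"
  using level_path[of u] by auto

lemma level_adj: "adj G u w \<Longrightarrow> level w \<le> Suc (level u)"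
  using level_path[of u] adjD[OF simple, of u w] by (intro level_le relpowp_Suc_I) auto

lemma ex_parent:
  assumes "u \<in> verts G" "u \<noteq> r"
  shows "\<exists>p. adj G p u \<and> level u = Suc (level p)"
proof -
  obtain m where m: "level u = Suc m" using assms level_0_iff not0_implies_Suc by blast
  then have "(adj G ^^ Suc m) r u" using level_path[OF assms(1)] by simp
  then obtain p where p: "(adj G ^^ m) r p" "adj G p u" by (rule relpowp_Suc_E)
  then show ?thesis using level_le[OF p(1)] level_adj[OF p(2)] m by (intro exI[of _ p]) auto
qed

text \<open>Along the chain of parents from \<open>x\<close> to \<open>r\<close> the level drops
  strictly, so after \<open>x\<close> only levels below that of \<open>u\<close> occur.\<close>

lemma root_path_avoiding:
  assumes "x \<in> verts G" "x \<noteq> u" "level x \<le> level u"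
  shows "(adj (delete_vertex G u))\<^sup>*\<^sup>* r x"
  using assms
proof (induction "level x" arbitrary: x rule: less_induct)
  case less
  show ?case
  proof (cases "x = r")
    case False
    then obtain p where p: "adj G p x" "level x = Suc (level p)" using ex_parent less.prems by blast
    then have "p \<noteq> u" using less.prems by auto
    then have "(adj (delete_vertex G u))\<^sup>*\<^sup>* r p"
      using less p adjD[OF simple p(1)] by simp
    moreover have "adj (delete_vertex G u) p x"
      using p \<open>p \<noteq> u\<close> less.prems by (simp add: adj_delete_vertex)
    ultimately show ?thesis by (rule rtranclp.rtrancl_into_rtrancl)
  qed simp
qed

lemma linked_adj:
  "adj G u a \<Longrightarrow> adj G u b \<Longrightarrow> a \<noteq> b \<Longrightarrow> (adj (delete_vertex G u))\<^sup>*\<^sup>* a b \<Longrightarrow> adj G a b"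
  using linked unfolding clique_linked_def by blast

lemma low_path_avoiding:
  assumes "a \<in> verts G" "b \<in> verts G" "a \<noteq> u" "b \<noteq> u" "level a \<le> level u" "level b \<le> level u"
  shows "(adj (delete_vertex G u))\<^sup>*\<^sup>* a b"
  using adj_rtranclp_sym[OF root_path_avoiding[of a u]] root_path_avoiding[of b u] assms
  by (meson rtranclp_trans)

text \<open>Both neighbours reach the root without passing \<open>u\<close>, so linkedness at
  \<open>u\<close> applies.\<close>

lemma low_neighbours_adj:
  assumes "adj G u a" "adj G u b" "a \<noteq> b" "level a \<le> level u" "level b \<le> level u"
  shows "adj G a b"
proof (rule linked_adj[OF assms(1-3)])
  show "(adj (delete_vertex G u))\<^sup>*\<^sup>* a b"
    using adjD[OF simple assms(1)] adjD[OF simple assms(2)] assms(4,5)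
    by (intro low_path_avoiding) auto
qed

text \<open>Two parents \<open>p\<close> and \<open>q\<close> of \<open>u\<close> would give a walk
  from a parent \<open>p'\<close> of \<open>p\<close> through \<open>q\<close> to \<open>u\<close>
  that avoids \<open>p\<close>. Linkedness at \<open>p\<close> makes \<open>p'\<close> adjacent to
  \<open>u\<close>, two levels below it.\<close>

lemma parent_unique:
  assumes p: "adj G p u" "level u = Suc (level p)" and q: "adj G q u" "level u = Suc (level q)"
  shows "p = q"
proof (rule ccontr)
  assume "p \<noteq> q"
  note pV = adjD[OF simple p(1)] and qV = adjD[OF simple q(1)]
  have pq: "adj G p q"
    using low_neighbours_adj[of u p q] p q \<open>p \<noteq> q\<close> adj_sym[of G u] by simp
  have "p \<noteq> r"
    using p q pV qV \<open>p \<noteq> q\<close> level_0_iff[of q] by auto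
  then obtain p' where p': "adj G p' p" "level p = Suc (level p')" using ex_parent pV by blast
  have ne: "p' \<noteq> q" "p' \<noteq> u" using p q p' by auto
  have "(adj (delete_vertex G p))\<^sup>*\<^sup>* p' q"
    using adjD[OF simple p'(1)] pV qV p q p' \<open>p \<noteq> q\<close> by (intro low_path_avoiding) auto
  moreover have "adj (delete_vertex G p) q u"
    using q pV \<open>p \<noteq> q\<close> by (simp add: adj_delete_vertex)
  ultimately have "(adj (delete_vertex G p))\<^sup>*\<^sup>* p' u" by (rule rtranclp.rtrancl_into_rtrancl)
  then have "adj G p' u" using linked_adj[of p p' u] p p' ne adj_sym[of G p p'] by simp
  then show False using level_adj[of p' u] p p' by simp
qed

text \<open>\<open>p\<close> and \<open>w\<close> are both neighbours of \<open>u\<close> that lie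
  no deeper than \<open>u\<close>.\<close>

lemma siblings_same_parent:
  assumes "adj G u w" "level u = level w" "adj G p u" "level u = Suc (level p)"
  shows "adj G p w"
proof -
  have "p \<noteq> w" using assms by auto
  then show ?thesis using low_neighbours_adj[of u p w] assms adj_sym[of G u p] by simp
qed

text \<open>The corona to be removed consists of the siblings of a second deepest vertex \<open>x\<close>
  together with all their children; \<open>no_private_pair\<close> at these vertices makes the set of children
  of each of them a nonempty clique.\<close>

lemma ex_corona_attachment:
  assumes npp: "no_private_pair G" and ncomp: "\<not> complete_graph G"
  shows "\<exists>G' v K H. corona_attachment G' v K H \<and> G = attach G' v (general_corona K H) (verts K) \<and>
           2 \<le> card (verts G')"
proof -
  have fin: "finite (verts G)" using simple by (simp add: simple_graph_def)
  note V = adjD[OF simple]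
  note sym = adj_sym[of G]
  obtain y where y: "y \<in> verts G" "\<And>z. z \<in> verts G \<Longrightarrow> level z \<le> level y"
  proof -
    have "Max (level ` verts G) \<in> level ` verts G" using fin root by (intro Max_in) auto
    then obtain y where "y \<in> verts G" "level y = Max (level ` verts G)" by auto
    then show thesis using that fin by simp
  qed
  \<comment> \<open>Otherwise all other vertices are neighbours of \<open>r\<close>, every
    neighbourhood lies in the closed one of \<open>r\<close>, and \<open>no_private_pair\<close> at
    \<open>r\<close> makes \<open>G\<close> complete.\<close>
  have "2 \<le> level y"
  proof (rule ccontr)
    assume "\<not> 2 \<le> level y"
    then have small: "level z \<le> 1" if "z \<in> verts G" for z using y(2)[OF that] by simp
    have adj_root: "adj G r z" if "z \<in> verts G" "z \<noteq> r" for z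
      using ex_parent[OF that] small[OF that(1)] level_0_iff V by (metis One_nat_def Suc_le_mono le_zero_eq)
    have "adj G a b" if "a \<in> verts G" "b \<in> verts G" "a \<noteq> b" for a b
    proof (cases "a = r \<or> b = r")
      case True
      then show ?thesis using adj_root that sym by metis
    next
      case False
      have "z = r \<or> adj G r z" if "adj G c z" for c z using adj_root V(2)[OF that] by blast
      then show ?thesis using no_private_pairD[OF npp, of r a b] adj_root that False by blast
    qed
    then show False using ncomp simple root unfolding complete_graph_def by blast
  qed
  then have "y \<noteq> r" by auto
  then obtain x where x: "adj G x y" "level y = Suc (level x)" using ex_parent y by blast
  then have "x \<noteq> r" using \<open>2 \<le> level y\<close> by auto
  then obtain v where v: "adj G v x" "level x = Suc (level v)" using ex_parent V(1)[OF x(1)] by blast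
  \<comment> \<open>Only siblings adjacent to \<open>x\<close> are taken; other children of
    \<open>v\<close> stay in the remaining graph. \<open>C w\<close> collects the children of
    \<open>w\<close>, the future leaves.\<close>
  define B where "B = {w \<in> verts G. level w = level x \<and> (w = x \<or> adj G x w)}"
  define C where "C w = {h. adj G w h \<and> level h = Suc (level w)}" for w
  have BV: "B \<subseteq> verts G" and CV: "C w \<subseteq> verts G" for w using V by (auto simp: B_def C_def)
  have xB: "x \<in> B" using V(1)[OF x(1)] by (simp add: B_def)
  have yC: "y \<in> C x" using x by (simp add: C_def)
  have vB: "adj G v w" if "w \<in> B" for w
    using that siblings_same_parent[of x w v] v by (auto simp: B_def)
  have clB: "adj G a b" if "a \<in> B" "b \<in> B" "a \<noteq> b" for a b
    using that low_neighbours_adj[of x a b] sym by (auto simp: B_def)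
  \<comment> \<open>A neighbour of \<open>w\<close> one level down is a child, one on the same level
    is joined to \<open>x\<close> by \<open>low_neighbours_adj\<close> at \<open>w\<close>, and one
    level up only the unique parent \<open>v\<close> is possible.\<close>
  have nbrB: "z = v \<or> z \<in> B \<or> z \<in> C w" if w: "w \<in> B" and wz: "adj G w z" for w z
  proof -
    have lw: "level w = level x" using w by (simp add: B_def)
    have "level z \<le> Suc (level w)" "level w \<le> Suc (level z)" using level_adj wz sym by blast+
    then consider "level z = Suc (level w)" | "level z = level w" | "level w = Suc (level z)" by linarith
    then show ?thesis
    proof cases
      case 1
      then show ?thesis using wz by (simp add: C_def)
    next
      case 2
      have "z = x \<or> adj G x z"
        using w wz 2 low_neighbours_adj[of w x z] sym[of w x] by (auto simp: B_def)
      then show ?thesis using 2 lw V(2)[OF wz] by (simp add: B_def)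
    next
      case 3
      then show ?thesis
        using parent_unique[of z w v] wz sym[of w z] vB[OF w] v lw by simp
    qed
  qed
  \<comment> \<open>\<open>h\<close> has the maximal level, so it has no children; its neighbours
    are its parent and siblings.\<close>
  have nbrC: "z = w \<or> z \<in> C w" if w: "w \<in> B" and h: "h \<in> C w" and hz: "adj G h z" for w h z
  proof -
    have lw: "level w = level x" using w by (simp add: B_def)
    have lh: "level h = level y" "adj G w h" "level h = Suc (level w)" using h lw x by (auto simp: C_def)
    have "level z \<le> level h" "level h \<le> Suc (level z)"
      using y(2)[OF V(2)[OF hz]] lh level_adj[of z h] hz sym by auto
    then consider "level z = level h" | "level h = Suc (level z)" by linarith
    then show ?thesis
    proof cases
      case 1
      then show ?thesis using siblings_same_parent[of h z w] hz lh by (simp add: C_def)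
    next
      case 2
      then show ?thesis using parent_unique[of z h w] lh hz sym[of h z] by simp
    qed
  qed
  have lvB: "level w = Suc (level v)" if "w \<in> B" for w using that v by (simp add: B_def)
  have lvC: "level h = Suc (Suc (level v))" if "w \<in> B" "h \<in> C w" for w h
    using that lvB by (simp add: C_def)
  have dBC: "h \<notin> B" "h \<noteq> v" if "w \<in> B" "h \<in> C w" for w h
    using lvB lvC[OF that] by force+
  have uniqC: "a = b" if "a \<in> B" "b \<in> B" "h \<in> C a" "h \<in> C b" for a b h
    using parent_unique[of a h b] that by (simp add: C_def)
  have nbrC': "z = w \<or> adj G w z" if "w \<in> B" "h \<in> C w" "adj G h z" for w h z
    using nbrC[OF that] by (auto simp: C_def)
  have CadjB: "adj G w h" if "h \<in> C w" for w h using that by (simp add: C_def)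
  have clC: "adj G a b" if w: "w \<in> B" and ab: "a \<in> C w" "b \<in> C w" "a \<noteq> b" for w a b
    by (rule no_private_pairD[OF npp CadjB[OF ab(1)] CadjB[OF ab(2)] ab(3)])
       (use nbrC'[OF w] ab in blast)+
  \<comment> \<open>\<open>y\<close> is a neighbour of \<open>x\<close> with its whole neighbourhood
    in the closed one of \<open>x\<close>. Any second such neighbour must be adjacent to
    \<open>y\<close>, which is used twice for a contradiction.\<close>
  have priv: "adj G b y" if xb: "adj G x b" "b \<noteq> y" and nb: "\<And>z. adj G b z \<Longrightarrow> z = x \<or> adj G x z" for b
    using no_private_pairD[OF npp xb(1) x(1) xb(2) nb nbrC'[OF xB yC]] .
  \<comment> \<open>A childless \<open>w\<close> in \<open>B\<close> has only \<open>v\<close> and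
    vertices of \<open>B\<close> as neighbours, so \<open>priv\<close> would make it adjacent to
    \<open>y\<close>.\<close>
  have Cne: "C w \<noteq> {}" if w: "w \<in> B" for w
  proof
    assume e: "C w = {}"
    then have "w \<noteq> x" using yC by blast
    then have xw: "adj G x w" using w by (simp add: B_def)
    have "w \<noteq> y" using dBC(1)[OF xB yC] w by blast
    moreover have "z = x \<or> adj G x z" if "adj G w z" for z
      using nbrB[OF w that] e vB[OF xB] sym[of v x] by (auto simp: B_def)
    ultimately have "adj G w y" using priv[OF xw] by blast
    then show False using nbrB[OF w] e dBC[OF xB yC] by blast
  qed
  define W where "W = B \<union> (\<Union>w \<in> B. C w)"
  define V' where "V' = verts G - W"
  have vV': "v \<in> V'"
  proof -
    have "v \<notin> B" using lvB[of v] by auto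
    moreover have "v \<notin> C w" if "w \<in> B" for w using lvC[OF that, of v] by auto
    ultimately show ?thesis using V(1)[OF v(1)] unfolding V'_def W_def by blast
  qed
  \<comment> \<open>The remaining graph needs order at least 2. If \<open>v\<close> were alone
    there, its neighbours would lie in \<open>B\<close>, and \<open>priv\<close> would join it to
    \<open>y\<close>, two levels deeper.\<close>
  have "\<exists>z \<in> V'. z \<noteq> v"
  proof (rule ccontr)
    assume neg: "\<not> ?thesis"
    have vx: "adj G x v" using v sym by simp
    have "z = x \<or> adj G x z" if z: "adj G v z" for z
    proof -
      have "z \<in> W" using neg V(2,3)[OF z] by (auto simp: V'_def)
      moreover have "z \<notin> C w" if "w \<in> B" for w
        using level_adj[OF z] lvC[OF that, of z] by auto
      ultimately have "z \<in> B" by (auto simp: W_def)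
      then show ?thesis by (simp add: B_def)
    qed
    moreover have "v \<noteq> y" using dBC(2)[OF xB yC] by simp
    ultimately have "adj G v y" using priv[OF vx] by blast
    then show False using level_adj[of v y] v x by simp
  qed
  then obtain z where z: "z \<in> V'" "z \<noteq> v" by blast
  have finV': "finite V'" using fin by (simp add: V'_def)
  have "card {v, z} \<le> card V'" using z vV' finV' by (intro card_mono) auto
  then have card: "2 \<le> card V'" using z by simp
  let ?G' = "induced G V'" and ?K = "complete_on B" and ?H = "\<lambda>w. complete_on (C w)"
  have CA: "corona_attachment ?G' v ?K ?H"
  proof
    show "simple_graph ?G'" using induced_subgraph[OF simple, of V'] by (auto simp: V'_def)
    show "v \<in> verts ?G'" using vV' by simp
    have "finite B" "finite (C w)" for w using BV CV fin finite_subset by blast+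
    then show "corona_family ?K ?H"
      using xB Cne dBC uniqC
      by (auto simp: corona_family_def disjnt_def intro!: complete_complete_on)
    show "disjnt (verts ?G') (verts (general_corona ?K ?H))"
      by (auto simp: disjnt_def general_corona_def V'_def W_def)
  qed
  then interpret A: corona_attachment ?G' v ?K ?H .
  have "G = A.G"
  proof (rule simple_graph_eqI[OF simple A.simple_G])
    show "verts G = verts A.G"
      unfolding A.verts_G using BV CV by (auto simp: V'_def W_def)
    have old: "a = v \<and> b \<in> B" if "adj G a b" "a \<in> V'" "b \<notin> V'" for a b
    proof -
      have "b \<in> W" using that V(2) by (auto simp: V'_def)
      moreover have False if "w \<in> B" "b \<in> C w" for w
        using nbrC[OF that] \<open>adj G a b\<close> sym \<open>a \<in> V'\<close> that(1) unfolding V'_def W_def by blast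
      ultimately have b: "b \<in> B" by (auto simp: W_def)
      then show ?thesis
        using nbrB[OF b] \<open>adj G a b\<close> sym \<open>a \<in> V'\<close> unfolding V'_def W_def by blast
    qed
    fix a b
    show "adj G a b \<longleftrightarrow> adj A.G a b"
    proof
      assume ab: "adj G a b"
      note ne = V(3)[OF ab]
      have ba: "adj G b a" using ab sym by simp
      consider "a \<in> V'" "b \<in> V'" | "a \<in> V'" "b \<notin> V'" | "a \<in> B" | w where "w \<in> B" "a \<in> C w"
        using V(1)[OF ab] by (auto simp: V'_def W_def)
      then show "adj A.G a b"
      proof cases
        case 1
        then show ?thesis unfolding A.adj_G_iff using ab by (simp add: adj_induced)
      next
        case 2
        then show ?thesis unfolding A.adj_G_iff using old[OF ab] by simp
      next
        case 3
        then show ?thesis unfolding A.adj_G_iff using nbrB[OF 3 ab] ne by auto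
      next
        case 4
        then show ?thesis unfolding A.adj_G_iff using nbrC[OF 4 ab] ne by auto
      qed
    next
      assume "adj A.G a b"
      then show "adj G a b"
        unfolding A.adj_G_iff unfolding adj_induced verts_complete_on
        using clB clC CadjB vB sym[of a b] by blast
    qed
  qed
  then show ?thesis using CA card by (intro exI[of _ ?G'] exI[of _ v] exI[of _ ?K] exI[of _ ?H]) auto
qed

end

subsection \<open>Excellent graphs and clique covers\<close>

text \<open>Exchange argument: in a maximum independent set through \<open>x\<close>, replacing
  \<open>x\<close> by non-adjacent \<open>a\<close> and \<open>b\<close> keeps independence, because
  their other neighbours are neighbours of \<open>x\<close>, and gains one vertex.\<close>

lemma alpha_excellent_no_private_pair:
  assumes G: "simple_graph G" and exc: "alpha_excellent G"
  shows "no_private_pair G"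
  unfolding no_private_pair_def
proof (intro allI impI, elim conjE, rule ccontr)
  fix x a b
  assume h: "adj G x a" "adj G x b" "a \<noteq> b" "\<forall>z. adj G a z \<longrightarrow> z = x \<or> adj G x z"
    "\<forall>z. adj G b z \<longrightarrow> z = x \<or> adj G x z" and nab: "\<not> adj G a b"
  obtain S where S: "maximum_independent_set G S" "x \<in> S"
    using exc adjD(1)[OF G h(1)] by (auto simp: alpha_excellent_def)
  have ind: "independent_set G S" using S by (simp add: maximum_independent_set_def)
  then have nS: "\<not> adj G p q" if "p \<in> S" "q \<in> S" for p q using that by (simp add: independent_set_def)
  have fin: "finite S"
    using ind G finite_subset by (auto simp: independent_set_def simple_graph_def)
  have "a \<notin> S" "b \<notin> S" using nS S(2) h by blast+
  let ?T = "insert a (insert b (S - {x}))"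
  have aS: "\<not> adj G a q" "\<not> adj G b q" if "q \<in> S - {x}" for q
    using h(4,5) nS[OF S(2)] that by blast+
  have "\<not> adj G p q" if "p \<in> ?T" "q \<in> ?T" for p q
    using that nS aS nab adjD(3)[OF G] adj_sym[of G p q] by blast
  then have "independent_set G ?T"
    using ind adjD(2)[OF G h(1)] adjD(2)[OF G h(2)] by (auto simp: independent_set_def)
  then have "card ?T \<le> card S" using S by (simp add: maximum_independent_set_def)
  moreover have "card ?T = Suc (card S)"
    using fin \<open>a \<notin> S\<close> \<open>b \<notin> S\<close> h(3) S(2) card_Suc_Diff1[OF fin S(2)] by simp
  ultimately show False by simp
qed

text \<open>The member covering \<open>a\<close> lies in the closed neighbourhood of
  \<open>x\<close> and hence contains \<open>x\<close> by maximality. The same holds for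
  \<open>b\<close>, so disjointness makes the two members equal.\<close>

lemma clique_cover_no_private_pair:
  assumes G: "simple_graph G" and P: "clique_cover G P"
  shows "no_private_pair G"
  unfolding no_private_pair_def
proof (intro allI impI, elim conjE)
  fix x a b
  assume h: "adj G x a" "adj G x b" "a \<noteq> b" and priv: "\<forall>z. adj G a z \<longrightarrow> z = x \<or> adj G x z"
    "\<forall>z. adj G b z \<longrightarrow> z = x \<or> adj G x z"
  have mem: "\<exists>Q \<in> P. c \<in> Q \<and> x \<in> Q"
    if xc: "adj G x c" and c: "\<forall>z. adj G c z \<longrightarrow> z = x \<or> adj G x z" for c
  proof -
    obtain Q where Q: "Q \<in> P" "c \<in> Q" using P adjD(2)[OF G xc] by (auto simp: clique_cover_def)
    then have max: "maximal_clique G Q" using P by (simp add: clique_cover_def)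
    then have cl: "clique G Q" by (simp add: maximal_clique_def)
    have "adj G x q" if "q \<in> Q" "x \<noteq> q" for q
      using clique_adj[OF cl Q(2) that(1)] c xc that by metis
    then show ?thesis using maximal_clique_in[OF max adjD(1)[OF G xc]] Q by blast
  qed
  obtain Q R where Q: "Q \<in> P" "a \<in> Q" "x \<in> Q" and R: "R \<in> P" "b \<in> R" "x \<in> R"
    using mem[OF h(1) priv(1)] mem[OF h(2) priv(2)] by (elim bexE conjE)
  then have "Q = R" using P unfolding clique_cover_def pairwise_def disjnt_def by blast
  moreover have "clique G Q" using P Q by (auto simp: clique_cover_def maximal_clique_def)
  ultimately show "adj G a b" using clique_adj Q R h(3) by metis
qed

text \<open>Induction on the order: a graph that is not complete loses a corona, and whichever
  alternative of the last hypothesis holds is inherited by the rest.\<close>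

lemma in_family_F:
  assumes "simple_graph G" "connected_graph G" "clique_linked G" "2 \<le> card (verts G)"
    and "alpha_excellent G \<or> (\<exists>P. clique_cover G P)"
  shows "G \<in> family_F"
  using assms
proof (induction "card (verts G)" arbitrary: G rule: less_induct)
  case less
  show ?case
  proof (cases "complete_graph G")
    case True
    then show ?thesis using family_F.complete less.prems by blast
  next
    case False
    obtain r where "r \<in> verts G" using less.prems(2) by (auto simp: connected_graph_def)
    then interpret rooted_linked_graph G r using less.prems by unfold_locales
    have "no_private_pair G"
      using less.prems(1,5) alpha_excellent_no_private_pair clique_cover_no_private_pair by blast
    then obtain G' v K H where A: "corona_attachment G' v K H"
      and G: "G = attach G' v (general_corona K H) (verts K)" and card: "2 \<le> card (verts G')"
      using ex_corona_attachment False by blast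
    interpret A: corona_attachment G' v K H by (rule A)
    have "alpha_excellent G' \<or> (\<exists>P. clique_cover G' P)"
      using less.prems(5) A.alpha_excellent_G' A.clique_cover_G' G by blast
    then have "G' \<in> family_F"
      using less.hyps[of G'] A.simple A.connected_G' A.clique_linked_G' card A.card_verts_less
        less.prems(2,3) unfolding G by simp
    then show ?thesis
      unfolding G using A.v A.corona A.disj by (rule family_F.attach_corona)
  qed
qed

text \<open>The existence of neighbours is carried through the induction because both excellence and
  the clique cover pass to the larger graph only if \<open>v\<close> has a neighbour in
  \<open>G'\<close>.\<close>

lemma family_F_properties:
  assumes "G \<in> family_F"
  shows "simple_graph G \<and> (\<forall>u \<in> verts G. \<exists>w. adj G u w) \<and> alpha_excellent G \<and> (\<exists>P. clique_cover G P)"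
  using assms
proof induction
  case (complete G)
  have G: "simple_graph G" using complete by (simp add: complete_graph_def)
  note adj = complete_graph_adj[OF complete(1)]
  have nbr: "\<exists>w. adj G u w" if "u \<in> verts G" for u
  proof -
    have "verts G \<noteq> {u}" using complete(2) by auto
    then show ?thesis using that adj by blast
  qed
  have "maximum_independent_set G {u}" if u: "u \<in> verts G" for u
    unfolding maximum_independent_set_def
  proof (intro conjI allI impI)
    show "independent_set G {u}" using u adj by (simp add: independent_set_def)
    fix T assume "independent_set G T"
    then have "p = q" if "p \<in> T" "q \<in> T" for p q
      using that adj unfolding independent_set_def by blast
    moreover have "finite T"
      using \<open>independent_set G T\<close> G finite_subset by (auto simp: independent_set_def simple_graph_def)
    ultimately show "card T \<le> card {u}" using card_le_Suc0_iff_eq[of T] by auto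
  qed
  then have "alpha_excellent G" unfolding alpha_excellent_def by blast
  moreover have "clique_cover G {verts G}"
    using adj by (auto simp: clique_cover_def maximal_clique_def clique_def)
  ultimately show ?case using G nbr by blast
next
  case (attach_corona G' v K H)
  interpret A: corona_attachment G' v K H using attach_corona by unfold_locales auto
  have nbr: "\<exists>w. adj G' v w" using attach_corona by blast
  have "\<exists>w. adj A.G u w" if u: "u \<in> verts A.G" for u
  proof -
    consider "u \<in> verts G'" | "u \<in> verts K" | x where "x \<in> verts K" "u \<in> verts (H x)"
      using u unfolding A.verts_G by blast
    then show ?thesis
    proof cases
      case 1
      then show ?thesis using attach_corona.IH A.adj_G_iff by blast
    qed (use A.adj_G_iff in blast)+
  qed
  then show ?case
    using A.simple_G A.alpha_excellent_G[OF _ nbr] A.clique_cover_G[OF _ nbr] attach_corona.IH by blast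
qed

theorem theorem4p7:
  fixes G :: "'a graph"
  assumes "block_graph G" and "connected_graph G" and "card (verts G) \<ge> 2"
  shows "(alpha_excellent G \<longleftrightarrow> G \<in> family_F) \<and>
         (G \<in> family_F \<longleftrightarrow> (\<exists>\<P>. perfect_block_cover G \<P>))"
proof -
  have "simple_graph G" using assms(1) by (simp add: block_graph_def)
  then show ?thesis
    using in_family_F[OF _ assms(2) block_graph_clique_linked[OF assms(1)] assms(3)]
      family_F_properties perfect_block_cover_iff_clique_cover[OF assms(1)]
    by blast
qed

end
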